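(* For any set $I$ of unary function symbols, the variety $\mathsf{MV}(I)$ of MV(I)-algebras has the congruence extension property: for every $\mathbf{B}\in\mathsf{MV}(I)$, every subalgebra $\mathbf{A}$ of $\mathbf{B}$ and every congruence $\theta$ of $\mathbf{A}$, there is a congruence $\xi$ of $\mathbf{B}$ with $\xi\cap A^2=\theta$.
   Context: An MV(I)-algebra is an algebra $(A,\wedge,\vee,\cdot,\to,0,1,\{\Box\}_{\Box\in I})$ whose reduct $(A,\wedge,\vee,\cdot,\to,0,1)$ is an MV-algebra and in which each $\Box\in I$ is a $\{\wedge,\cdot,0,1\}$-endomorphism of that MV-algebra (i.e., $\Box(x\wedge y)=\Box x\wedge\Box y$, $\Box(xy)=\Box x\cdot\Box y$, $\Box0=0$, $\Box1=1$). *)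

theory Defs
  imports "HOL-Algebra.Group"
begin

text \<open>
  MV-algebras are presented in the residuated signature: bounded commutative integral residuated
  lattices satisfying \<open>(x \<leadsto> y) \<leadsto> y = x \<curlyvee> y\<close>. The monoid unit \<open>\<one>\<close> is the top element.
\<close>

record 'a mv_algebra = "'a monoid" +
  mv_meet :: "['a, 'a] \<Rightarrow> 'a" (infixl \<open>\<curlywedge>\<index>\<close> 65)
  mv_join :: "['a, 'a] \<Rightarrow> 'a" (infixl \<open>\<curlyvee>\<index>\<close> 65)
  mv_imp :: "['a, 'a] \<Rightarrow> 'a" (infixr \<open>\<leadsto>\<index>\<close> 60)
  mv_zero :: 'a (\<open>\<zero>\<index>\<close>)

record ('a, 'i) mvi_algebra = "'a mv_algebra" +
  mv_box :: "['i, 'a] \<Rightarrow> 'a" (\<open>\<box>\<index>\<close>)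

locale mv_algebra = comm_monoid A for A (structure) +
  assumes meet_closed: "\<lbrakk>x \<in> carrier A; y \<in> carrier A\<rbrakk> \<Longrightarrow> x \<curlywedge> y \<in> carrier A"
    and join_closed: "\<lbrakk>x \<in> carrier A; y \<in> carrier A\<rbrakk> \<Longrightarrow> x \<curlyvee> y \<in> carrier A"
    and imp_closed: "\<lbrakk>x \<in> carrier A; y \<in> carrier A\<rbrakk> \<Longrightarrow> (x \<leadsto> y) \<in> carrier A"
    and zero_closed: "\<zero> \<in> carrier A"
    and meet_comm: "\<lbrakk>x \<in> carrier A; y \<in> carrier A\<rbrakk> \<Longrightarrow> x \<curlywedge> y = y \<curlywedge> x"
    and join_comm: "\<lbrakk>x \<in> carrier A; y \<in> carrier A\<rbrakk> \<Longrightarrow> x \<curlyvee> y = y \<curlyvee> x"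
    and meet_assoc: "\<lbrakk>x \<in> carrier A; y \<in> carrier A; z \<in> carrier A\<rbrakk>
          \<Longrightarrow> (x \<curlywedge> y) \<curlywedge> z = x \<curlywedge> (y \<curlywedge> z)"
    and join_assoc: "\<lbrakk>x \<in> carrier A; y \<in> carrier A; z \<in> carrier A\<rbrakk>
          \<Longrightarrow> (x \<curlyvee> y) \<curlyvee> z = x \<curlyvee> (y \<curlyvee> z)"
    and meet_absorb: "\<lbrakk>x \<in> carrier A; y \<in> carrier A\<rbrakk> \<Longrightarrow> x \<curlywedge> (x \<curlyvee> y) = x"
    and join_absorb: "\<lbrakk>x \<in> carrier A; y \<in> carrier A\<rbrakk> \<Longrightarrow> x \<curlyvee> (x \<curlywedge> y) = x"
    and zero_least: "x \<in> carrier A \<Longrightarrow> \<zero> \<curlywedge> x = \<zero>"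
    and one_greatest: "x \<in> carrier A \<Longrightarrow> x \<curlywedge> \<one> = x"
    and residuation: "\<lbrakk>x \<in> carrier A; y \<in> carrier A; z \<in> carrier A\<rbrakk>
          \<Longrightarrow> (x \<otimes> y) \<curlywedge> z = x \<otimes> y \<longleftrightarrow> x \<curlywedge> (y \<leadsto> z) = x"
    and imp_imp_join: "\<lbrakk>x \<in> carrier A; y \<in> carrier A\<rbrakk> \<Longrightarrow> ((x \<leadsto> y) \<leadsto> y) = x \<curlyvee> y"

locale mvi_algebra = mv_algebra A for I :: "'i set" and A :: "('a, 'i, 'm) mvi_algebra_scheme" (structure) +
  assumes box_closed: "\<lbrakk>i \<in> I; x \<in> carrier A\<rbrakk> \<Longrightarrow> \<box> i x \<in> carrier A"
    and box_meet: "\<lbrakk>i \<in> I; x \<in> carrier A; y \<in> carrier A\<rbrakk> \<Longrightarrow> \<box> i (x \<curlywedge> y) = \<box> i x \<curlywedge> \<box> i y"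
    and box_mult: "\<lbrakk>i \<in> I; x \<in> carrier A; y \<in> carrier A\<rbrakk> \<Longrightarrow> \<box> i (x \<otimes> y) = \<box> i x \<otimes> \<box> i y"
    and box_zero: "i \<in> I \<Longrightarrow> \<box> i \<zero> = \<zero>"
    and box_one: "i \<in> I \<Longrightarrow> \<box> i \<one> = \<one>"

definition MV :: "'i set \<Rightarrow> ('a, 'i) mvi_algebra set" where
  "MV I = {A. mvi_algebra I A}"

text \<open>
  A subalgebra of \<open>B\<close> is given by its universe \<open>S\<close>; as an algebra it is \<open>B\<lparr>carrier := S\<rparr>\<close>.
\<close>

definition subalgebra :: "'i set \<Rightarrow> 'a set \<Rightarrow> ('a, 'i) mvi_algebra \<Rightarrow> bool" where
  "subalgebra I S B \<longleftrightarrow>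
     S \<subseteq> carrier B \<and> \<zero>\<^bsub>B\<^esub> \<in> S \<and> \<one>\<^bsub>B\<^esub> \<in> S \<and>
     (\<forall>x\<in>S. \<forall>y\<in>S. x \<curlywedge>\<^bsub>B\<^esub> y \<in> S \<and> x \<curlyvee>\<^bsub>B\<^esub> y \<in> S \<and> x \<otimes>\<^bsub>B\<^esub> y \<in> S \<and> (x \<leadsto>\<^bsub>B\<^esub> y) \<in> S) \<and>
     (\<forall>i\<in>I. \<forall>x\<in>S. \<box>\<^bsub>B\<^esub> i x \<in> S)"

definition congruence :: "'i set \<Rightarrow> ('a, 'i) mvi_algebra \<Rightarrow> ('a \<times> 'a) set \<Rightarrow> bool" where
  "congruence I A \<theta> \<longleftrightarrow>
     equiv (carrier A) \<theta> \<and>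
     (\<forall>(x, x')\<in>\<theta>. \<forall>(y, y')\<in>\<theta>.
        (x \<curlywedge>\<^bsub>A\<^esub> y, x' \<curlywedge>\<^bsub>A\<^esub> y') \<in> \<theta> \<and> (x \<curlyvee>\<^bsub>A\<^esub> y, x' \<curlyvee>\<^bsub>A\<^esub> y') \<in> \<theta> \<and>
        (x \<otimes>\<^bsub>A\<^esub> y, x' \<otimes>\<^bsub>A\<^esub> y') \<in> \<theta> \<and> (x \<leadsto>\<^bsub>A\<^esub> y, x' \<leadsto>\<^bsub>A\<^esub> y') \<in> \<theta>) \<and>
     (\<forall>i\<in>I. \<forall>(x, x')\<in>\<theta>. (\<box>\<^bsub>A\<^esub> i x, \<box>\<^bsub>A\<^esub> i x') \<in> \<theta>)"

definition congruence_extension_property :: "'i set \<Rightarrow> ('a, 'i) mvi_algebra set \<Rightarrow> bool" where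
  "congruence_extension_property I K \<longleftrightarrow>
     (\<forall>B\<in>K. \<forall>S \<theta>. subalgebra I S B \<longrightarrow> congruence I (B\<lparr>carrier := S\<rparr>) \<theta> \<longrightarrow>
        (\<exists>\<xi>. congruence I B \<xi> \<and> \<xi> \<inter> (S \<times> S) = \<theta>))"

end

theory Submission
  imports Defs
begin

text \<open>
  Let \<open>F\<close> be the class of \<open>\<one>\<close> under a congruence \<open>\<theta>\<close> of the subalgebra. Call \<open>x\<close> and \<open>y\<close>
  equivalent in the big algebra if \<open>g \<otimes> x \<preceq> y\<close> and \<open>g \<otimes> y \<preceq> x\<close> for some \<open>g \<in> F\<close>. This is the
  congruence of the filter that \<open>F\<close> generates; it respects the boxes because they are monotone and
  multiplicative and map \<open>F\<close> into \<open>F\<close>. On the subalgebra it is \<open>\<theta>\<close>: modulo \<open>\<theta>\<close> the factor \<open>g\<close>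
  is \<open>\<one>\<close>, and conversely \<open>g = (x \<leadsto> y) \<otimes> (y \<leadsto> x)\<close> is a witness for \<open>(x, y) \<in> \<theta>\<close>.
\<close>

text \<open>The order is encoded by the meet because the boxes preserve meets: an inequality is then
  an equation whose image under a box is again an inequality.\<close>

definition le :: "('a, 'm) mv_algebra_scheme \<Rightarrow> 'a \<Rightarrow> 'a \<Rightarrow> bool" (infix \<open>\<preceq>\<index>\<close> 50)
  where "x \<preceq>\<^bsub>A\<^esub> y \<longleftrightarrow> x \<curlywedge>\<^bsub>A\<^esub> y = x"

text \<open>By residuation both inequalities say that \<open>g\<close> lies below
  \<open>x \<leadsto> y\<close> and \<open>y \<leadsto> x\<close>. A lower bound in \<open>F\<close>
  thus replaces membership of these implications in the upward closure of \<open>F\<close>.\<close>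

definition filter_rel :: "('a, 'm) mv_algebra_scheme \<Rightarrow> 'a set \<Rightarrow> ('a \<times> 'a) set" where
  "filter_rel A F = {(x, y). x \<in> carrier A \<and> y \<in> carrier A \<and>
     (\<exists>g\<in>F. g \<otimes>\<^bsub>A\<^esub> x \<preceq>\<^bsub>A\<^esub> y \<and> g \<otimes>\<^bsub>A\<^esub> y \<preceq>\<^bsub>A\<^esub> x)}"

section \<open>Order and residuation in MV-algebras\<close>

context mv_algebra
begin

lemmas closed = m_closed meet_closed join_closed imp_closed zero_closed one_closed

text \<open>The two absorption laws together make the meet idempotent.\<close>

lemma le_refl: "x \<in> carrier A \<Longrightarrow> x \<preceq> x"
  using meet_absorb[of x "x \<curlywedge> x"] join_absorb[of x x] by (simp add: le_def meet_closed)

lemma le_trans: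
  assumes "x \<preceq> y" "y \<preceq> z" "x \<in> carrier A" "y \<in> carrier A" "z \<in> carrier A"
  shows "x \<preceq> z"
  using assms meet_assoc[of x y z] by (simp add: le_def)

lemma le_one: "x \<in> carrier A \<Longrightarrow> x \<preceq> \<one>"
  by (simp add: le_def one_greatest)

lemma meet_le1: "\<lbrakk>x \<in> carrier A; y \<in> carrier A\<rbrakk> \<Longrightarrow> x \<curlywedge> y \<preceq> x"
  using le_refl[of x] meet_assoc[of x x y] meet_comm[of "x \<curlywedge> y" x] by (simp add: le_def meet_closed)

lemma meet_le2: "\<lbrakk>x \<in> carrier A; y \<in> carrier A\<rbrakk> \<Longrightarrow> x \<curlywedge> y \<preceq> y"
  using meet_le1[of y x] meet_comm[of x y] by simp

lemma le_meetI:
  assumes "z \<preceq> x" "z \<preceq> y" "x \<in> carrier A" "y \<in> carrier A" "z \<in> carrier A"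
  shows "z \<preceq> x \<curlywedge> y"
  using assms meet_assoc[of z x y] by (simp add: le_def)

lemma le_iff_join:
  assumes "x \<in> carrier A" "y \<in> carrier A"
  shows "x \<preceq> y \<longleftrightarrow> x \<curlyvee> y = y"
  unfolding le_def
  using assms join_absorb[of y x] join_comm[of x y] meet_absorb[of x y] meet_comm[of x y] by auto

lemma le_join1: "\<lbrakk>x \<in> carrier A; y \<in> carrier A\<rbrakk> \<Longrightarrow> x \<preceq> x \<curlyvee> y"
  by (simp add: le_def meet_absorb)

lemma le_join2: "\<lbrakk>x \<in> carrier A; y \<in> carrier A\<rbrakk> \<Longrightarrow> y \<preceq> x \<curlyvee> y"
  using le_join1[of y x] join_comm[of x y] by simp

lemma join_leI:
  assumes "x \<preceq> z" "y \<preceq> z" "x \<in> carrier A" "y \<in> carrier A" "z \<in> carrier A"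
  shows "x \<curlyvee> y \<preceq> z"
  using assms by (simp add: le_iff_join join_closed join_assoc)

lemma le_imp_iff:
  assumes "x \<in> carrier A" "y \<in> carrier A" "z \<in> carrier A"
  shows "x \<preceq> (y \<leadsto> z) \<longleftrightarrow> x \<otimes> y \<preceq> z"
  using residuation[of x y z] assms by (simp add: le_def)

lemma imp_mult_le: "\<lbrakk>x \<in> carrier A; y \<in> carrier A\<rbrakk> \<Longrightarrow> (x \<leadsto> y) \<otimes> x \<preceq> y"
  using le_imp_iff[of "x \<leadsto> y" x y] by (simp add: le_refl imp_closed)

lemma imp_self: "x \<in> carrier A \<Longrightarrow> (x \<leadsto> x) = \<one>"
  using le_imp_iff[of \<one> x x] le_refl[of x] one_greatest[of "x \<leadsto> x"] meet_comm[of \<one> "x \<leadsto> x"]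
  by (simp add: le_def imp_closed)

text \<open>Residuation is an adjunction: its unit puts \<open>y\<close>, hence also
  \<open>x\<close>, below \<open>z \<leadsto> y \<otimes> z\<close>, and transposing back gives the
  claim.\<close>

lemma mult_mono1:
  assumes "x \<preceq> y" "x \<in> carrier A" "y \<in> carrier A" "z \<in> carrier A"
  shows "x \<otimes> z \<preceq> y \<otimes> z"
proof -
  have "y \<preceq> (z \<leadsto> y \<otimes> z)"
    using assms by (simp add: le_imp_iff le_refl)
  then show ?thesis
    using assms le_trans le_imp_iff by (meson closed)
qed

lemma mult_mono:
  assumes "x \<preceq> y" "u \<preceq> v" "x \<in> carrier A" "y \<in> carrier A" "u \<in> carrier A" "v \<in> carrier A"
  shows "x \<otimes> u \<preceq> y \<otimes> v"
proof (rule le_trans)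
  show "x \<otimes> u \<preceq> y \<otimes> u"
    using assms by (simp add: mult_mono1)
  show "y \<otimes> u \<preceq> y \<otimes> v"
    using assms mult_mono1[of u v y] by (simp add: m_comm)
qed (use assms in simp_all)

lemma mult_le1: "\<lbrakk>x \<in> carrier A; y \<in> carrier A\<rbrakk> \<Longrightarrow> x \<otimes> y \<preceq> x"
  using mult_mono[of x x y \<one>] by (simp add: le_refl le_one)

lemma mult_le2: "\<lbrakk>x \<in> carrier A; y \<in> carrier A\<rbrakk> \<Longrightarrow> x \<otimes> y \<preceq> y"
  using mult_le1[of y x] m_comm[of x y] by simp

text \<open>This is the half of distributivity that joins require. Residuation moves
  \<open>g\<close> to the right, where the least upper bound property applies.\<close>

lemma mult_join_le:
  assumes "g \<otimes> x \<preceq> z" "g \<otimes> y \<preceq> z"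
    and "g \<in> carrier A" "x \<in> carrier A" "y \<in> carrier A" "z \<in> carrier A"
  shows "g \<otimes> (x \<curlyvee> y) \<preceq> z"
proof -
  have "x \<preceq> (g \<leadsto> z)" "y \<preceq> (g \<leadsto> z)"
    using assms by (simp_all add: le_imp_iff m_comm)
  then have "x \<curlyvee> y \<preceq> (g \<leadsto> z)"
    using assms by (simp add: join_leI closed)
  then show ?thesis
    using assms by (simp add: le_imp_iff m_comm closed)
qed

section \<open>Inequalities up to a factor, and their behaviour under the operations\<close>

lemma scaled_trans:
  assumes "g \<otimes> x \<preceq> y" "h \<otimes> y \<preceq> z" "g \<in> carrier A" "h \<in> carrier A"
    and "x \<in> carrier A" "y \<in> carrier A" "z \<in> carrier A"
  shows "(g \<otimes> h) \<otimes> x \<preceq> z"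
proof (rule le_trans)
  have "(g \<otimes> h) \<otimes> x = h \<otimes> (g \<otimes> x)"
    using assms by (simp add: m_ac)
  also have "\<dots> \<preceq> h \<otimes> y"
    using assms by (intro mult_mono le_refl closed)
  finally show "(g \<otimes> h) \<otimes> x \<preceq> h \<otimes> y" .
qed (use assms in simp_all)

context
  fixes g h x x' y y'
  assumes carr: "g \<in> carrier A" "h \<in> carrier A" "x \<in> carrier A" "x' \<in> carrier A"
      "y \<in> carrier A" "y' \<in> carrier A"
    and hy: "h \<otimes> y \<preceq> y'"
begin

text \<open>As \<open>\<one>\<close> is the top element, a product lies below each of its factors,
  so \<open>g \<otimes> h\<close> can serve in place of either.\<close>

lemma scaled_weaken:
  assumes "g \<otimes> x \<preceq> x'"
  shows "(g \<otimes> h) \<otimes> x \<preceq> x'" and "(g \<otimes> h) \<otimes> y \<preceq> y'"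
proof -
  have "(g \<otimes> h) \<otimes> x \<preceq> g \<otimes> x" "(g \<otimes> h) \<otimes> y \<preceq> h \<otimes> y"
    using carr by (simp_all add: mult_mono mult_le1 mult_le2 le_refl)
  then show "(g \<otimes> h) \<otimes> x \<preceq> x'" "(g \<otimes> h) \<otimes> y \<preceq> y'"
    using carr hy assms by (meson le_trans closed)+
qed

lemma scaled_meet:
  assumes "g \<otimes> x \<preceq> x'"
  shows "(g \<otimes> h) \<otimes> (x \<curlywedge> y) \<preceq> x' \<curlywedge> y'"
proof -
  have "(g \<otimes> h) \<otimes> (x \<curlywedge> y) \<preceq> (g \<otimes> h) \<otimes> x" "(g \<otimes> h) \<otimes> (x \<curlywedge> y) \<preceq> (g \<otimes> h) \<otimes> y"
    using carr by (simp_all add: mult_mono meet_le1 meet_le2 le_refl closed)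
  then have "(g \<otimes> h) \<otimes> (x \<curlywedge> y) \<preceq> x'" "(g \<otimes> h) \<otimes> (x \<curlywedge> y) \<preceq> y'"
    using scaled_weaken[OF assms] carr by (meson le_trans closed)+
  then show ?thesis
    using carr by (simp add: le_meetI closed)
qed

lemma scaled_join:
  assumes "g \<otimes> x \<preceq> x'"
  shows "(g \<otimes> h) \<otimes> (x \<curlyvee> y) \<preceq> x' \<curlyvee> y'"
proof (rule mult_join_le)
  show "(g \<otimes> h) \<otimes> x \<preceq> x' \<curlyvee> y'" "(g \<otimes> h) \<otimes> y \<preceq> x' \<curlyvee> y'"
    using scaled_weaken[OF assms] carr le_join1[of x' y'] le_join2[of x' y']
    by (meson le_trans closed)+
qed (use carr in \<open>simp_all add: closed\<close>)

lemma scaled_mult: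
  assumes "g \<otimes> x \<preceq> x'"
  shows "(g \<otimes> h) \<otimes> (x \<otimes> y) \<preceq> x' \<otimes> y'"
proof -
  have "(g \<otimes> h) \<otimes> (x \<otimes> y) = (g \<otimes> x) \<otimes> (h \<otimes> y)"
    using carr by (simp add: m_ac)
  then show ?thesis
    using carr hy assms by (simp add: mult_mono)
qed

text \<open>Implication reverses the order in its first argument, so the assumption on
  \<open>x\<close> and \<open>x'\<close> runs opposite to the one in the lemmas for the other
  operations.\<close>

lemma scaled_imp:
  assumes "g \<otimes> x' \<preceq> x"
  shows "(g \<otimes> h) \<otimes> (x \<leadsto> y) \<preceq> (x' \<leadsto> y')"
proof -
  \<comment> \<open>After residuation, \<open>g\<close> carries \<open>x'\<close> below
    \<open>x\<close>, modus ponens leads to \<open>y\<close>, and \<open>h\<close> carries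
    \<open>y\<close> below \<open>y'\<close>.\<close>
  have "((g \<otimes> h) \<otimes> (x \<leadsto> y)) \<otimes> x' = (h \<otimes> (x \<leadsto> y)) \<otimes> (g \<otimes> x')"
    using carr by (simp add: m_ac closed)
  also have "\<dots> \<preceq> (h \<otimes> (x \<leadsto> y)) \<otimes> x"
    using carr assms by (intro mult_mono le_refl closed)
  finally have 1: "((g \<otimes> h) \<otimes> (x \<leadsto> y)) \<otimes> x' \<preceq> h \<otimes> ((x \<leadsto> y) \<otimes> x)"
    using carr by (simp add: m_assoc closed)
  have "h \<otimes> ((x \<leadsto> y) \<otimes> x) \<preceq> h \<otimes> y"
    using carr by (intro mult_mono le_refl imp_mult_le closed)
  then have "((g \<otimes> h) \<otimes> (x \<leadsto> y)) \<otimes> x' \<preceq> y'"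
    using 1 carr hy by (meson le_trans closed)
  then show ?thesis
    using carr by (simp add: le_imp_iff closed)
qed

end

end

section \<open>Congruences from multiplicative submonoids closed under the boxes\<close>

lemma (in mvi_algebra) scaled_box:
  assumes "i \<in> I" "g \<in> carrier A" "x \<in> carrier A" "y \<in> carrier A" "g \<otimes> x \<preceq> y"
  shows "\<box> i g \<otimes> \<box> i x \<preceq> \<box> i y"
  \<comment> \<open>Preservation of meets gives monotonicity; multiplicativity then splits off
    \<open>\<box> i g\<close> as the new factor.\<close>
  using assms box_meet[of i "g \<otimes> x" y] by (simp add: le_def box_mult)

text \<open>Each closure property of \<open>F\<close> supplies witnesses: the unit for reflexivity,
  products for transitivity and the binary operations, boxes for compatibility with the
  boxes.\<close>

lemma congruence_filter_rel:
  fixes B :: "('a, 'i) mvi_algebra"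
  assumes "mvi_algebra I B"
    and F: "F \<subseteq> carrier B" "\<one>\<^bsub>B\<^esub> \<in> F" "\<And>g h. \<lbrakk>g \<in> F; h \<in> F\<rbrakk> \<Longrightarrow> g \<otimes>\<^bsub>B\<^esub> h \<in> F"
      "\<And>i g. \<lbrakk>i \<in> I; g \<in> F\<rbrakk> \<Longrightarrow> \<box>\<^bsub>B\<^esub> i g \<in> F"
  shows "congruence I B (filter_rel B F)"
proof -
  interpret mvi_algebra I B by fact
  let ?R = "filter_rel B F"
  have relI: "(x, y) \<in> ?R"
    if "g \<in> F" "g \<otimes>\<^bsub>B\<^esub> x \<preceq>\<^bsub>B\<^esub> y" "g \<otimes>\<^bsub>B\<^esub> y \<preceq>\<^bsub>B\<^esub> x" "x \<in> carrier B" "y \<in> carrier B" for g x y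
    using that by (auto simp: filter_rel_def)
  have relE: "\<exists>g\<in>F. g \<in> carrier B \<and> g \<otimes>\<^bsub>B\<^esub> x \<preceq>\<^bsub>B\<^esub> y \<and> g \<otimes>\<^bsub>B\<^esub> y \<preceq>\<^bsub>B\<^esub> x \<and> x \<in> carrier B \<and> y \<in> carrier B"
    if "(x, y) \<in> ?R" for x y
    using that F(1) by (auto simp: filter_rel_def)
  have "equiv (carrier B) ?R"
  proof (rule equivI)
    show "?R \<subseteq> carrier B \<times> carrier B"
      by (auto simp: filter_rel_def)
    show "refl_on (carrier B) ?R"
      by (rule refl_onI) (use F(2) le_refl in \<open>auto simp: filter_rel_def intro!: bexI[of _ "\<one>\<^bsub>B\<^esub>"]\<close>)
    show "sym ?R"
      by (auto simp: sym_def filter_rel_def)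
    show "trans ?R"
    proof (rule transI)
      fix x y z assume "(x, y) \<in> ?R" "(y, z) \<in> ?R"
      then obtain g h where gh: "g \<in> F" "h \<in> F"
          "g \<otimes>\<^bsub>B\<^esub> x \<preceq>\<^bsub>B\<^esub> y" "g \<otimes>\<^bsub>B\<^esub> y \<preceq>\<^bsub>B\<^esub> x" "h \<otimes>\<^bsub>B\<^esub> y \<preceq>\<^bsub>B\<^esub> z" "h \<otimes>\<^bsub>B\<^esub> z \<preceq>\<^bsub>B\<^esub> y"
        and c: "g \<in> carrier B" "h \<in> carrier B" "x \<in> carrier B" "y \<in> carrier B" "z \<in> carrier B"
        by (meson relE)
      have "(g \<otimes>\<^bsub>B\<^esub> h) \<otimes>\<^bsub>B\<^esub> x \<preceq>\<^bsub>B\<^esub> z"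
        using gh c by (intro scaled_trans[of g x y])
      \<comment> \<open>The way back from \<open>z\<close> to \<open>x\<close> uses \<open>h\<close>
        first, so commutativity is needed to obtain the same witness.\<close>
      moreover have "(g \<otimes>\<^bsub>B\<^esub> h) \<otimes>\<^bsub>B\<^esub> z \<preceq>\<^bsub>B\<^esub> x"
        using scaled_trans[of h z y g x] gh c m_comm[of g h] by simp
      ultimately show "(x, z) \<in> ?R"
        using relI F(3) gh c by blast
    qed
  qed
  moreover have "(x \<curlywedge>\<^bsub>B\<^esub> y, x' \<curlywedge>\<^bsub>B\<^esub> y') \<in> ?R \<and> (x \<curlyvee>\<^bsub>B\<^esub> y, x' \<curlyvee>\<^bsub>B\<^esub> y') \<in> ?R \<and>
      (x \<otimes>\<^bsub>B\<^esub> y, x' \<otimes>\<^bsub>B\<^esub> y') \<in> ?R \<and> (x \<leadsto>\<^bsub>B\<^esub> y, x' \<leadsto>\<^bsub>B\<^esub> y') \<in> ?R"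
    if xy: "(x, x') \<in> ?R" "(y, y') \<in> ?R" for x x' y y'
  proof -
    obtain g h where gh: "g \<in> F" "h \<in> F" "g \<otimes>\<^bsub>B\<^esub> x \<preceq>\<^bsub>B\<^esub> x'" "g \<otimes>\<^bsub>B\<^esub> x' \<preceq>\<^bsub>B\<^esub> x"
        "h \<otimes>\<^bsub>B\<^esub> y \<preceq>\<^bsub>B\<^esub> y'" "h \<otimes>\<^bsub>B\<^esub> y' \<preceq>\<^bsub>B\<^esub> y"
      and c: "g \<in> carrier B" "h \<in> carrier B" "x \<in> carrier B" "x' \<in> carrier B"
        "y \<in> carrier B" "y' \<in> carrier B"
      using xy by (meson relE)
    show ?thesis
      \<comment> \<open>The single witness \<open>g \<otimes> h\<close> serves all four operations
        in both directions.\<close>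
      by (intro conjI relI[of "g \<otimes>\<^bsub>B\<^esub> h"] scaled_meet scaled_join scaled_mult scaled_imp
          closed F(3) gh c)
  qed
  moreover have "(\<box>\<^bsub>B\<^esub> i x, \<box>\<^bsub>B\<^esub> i x') \<in> ?R" if i: "i \<in> I" and x: "(x, x') \<in> ?R" for i x x'
  proof -
    obtain g where "g \<in> F" "g \<in> carrier B" "g \<otimes>\<^bsub>B\<^esub> x \<preceq>\<^bsub>B\<^esub> x'" "g \<otimes>\<^bsub>B\<^esub> x' \<preceq>\<^bsub>B\<^esub> x"
        "x \<in> carrier B" "x' \<in> carrier B"
      using relE[OF x] by blast
    then show ?thesis
      using i by (intro relI[of "\<box>\<^bsub>B\<^esub> i g"] scaled_box box_closed F(4))
  qed
  ultimately show ?thesis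
    unfolding congruence_def by auto
qed

section \<open>Extending a congruence from a subalgebra\<close>

theorem theorem2:
  fixes I :: "'i set"
  shows "congruence_extension_property I (MV I :: ('a, 'i) mvi_algebra set)"
  unfolding congruence_extension_property_def
proof (intro ballI allI impI)
  fix B :: "('a, 'i) mvi_algebra" and S \<theta>
  assume "B \<in> MV I" and S: "subalgebra I S B" and \<theta>: "congruence I (B\<lparr>carrier := S\<rparr>) \<theta>"
  then interpret mvi_algebra I B by (simp add: MV_def)
  have SB: "S \<subseteq> carrier B" and one_S: "\<one>\<^bsub>B\<^esub> \<in> S"
    using S by (auto simp: subalgebra_def)
  have eq: "equiv S \<theta>"
    and meet: "\<And>x x' y y'. \<lbrakk>(x, x') \<in> \<theta>; (y, y') \<in> \<theta>\<rbrakk> \<Longrightarrow> (x \<curlywedge>\<^bsub>B\<^esub> y, x' \<curlywedge>\<^bsub>B\<^esub> y') \<in> \<theta>"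
    and mult: "\<And>x x' y y'. \<lbrakk>(x, x') \<in> \<theta>; (y, y') \<in> \<theta>\<rbrakk> \<Longrightarrow> (x \<otimes>\<^bsub>B\<^esub> y, x' \<otimes>\<^bsub>B\<^esub> y') \<in> \<theta>"
    and imp: "\<And>x x' y y'. \<lbrakk>(x, x') \<in> \<theta>; (y, y') \<in> \<theta>\<rbrakk> \<Longrightarrow> (x \<leadsto>\<^bsub>B\<^esub> y, x' \<leadsto>\<^bsub>B\<^esub> y') \<in> \<theta>"
    and box: "\<And>i x x'. \<lbrakk>i \<in> I; (x, x') \<in> \<theta>\<rbrakk> \<Longrightarrow> (\<box>\<^bsub>B\<^esub> i x, \<box>\<^bsub>B\<^esub> i x') \<in> \<theta>"
    using \<theta> by (auto simp: congruence_def)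
  have \<theta>_S: "\<theta> \<subseteq> S \<times> S" and refl: "\<And>x. x \<in> S \<Longrightarrow> (x, x) \<in> \<theta>"
    and sym: "\<And>x y. (x, y) \<in> \<theta> \<Longrightarrow> (y, x) \<in> \<theta>"
    and trans: "\<And>x y z. \<lbrakk>(x, y) \<in> \<theta>; (y, z) \<in> \<theta>\<rbrakk> \<Longrightarrow> (x, z) \<in> \<theta>"
    using eq by (auto simp: equiv_def refl_on_def dest: symD transD)
  define F where "F = {g. (g, \<one>\<^bsub>B\<^esub>) \<in> \<theta>}"
  have "congruence I B (filter_rel B F)"
  proof (rule congruence_filter_rel)
    show "mvi_algebra I B" by unfold_locales
    show "F \<subseteq> carrier B" "\<one>\<^bsub>B\<^esub> \<in> F"
      using \<theta>_S SB one_S refl by (auto simp: F_def)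
    \<comment> \<open>The class of \<open>\<one>\<close> inherits this closure from
      \<open>\<theta>\<close> because \<open>\<one> \<otimes> \<one> = \<one>\<close>; for the boxes
      the reason is \<open>\<box> i \<one> = \<one>\<close>.\<close>
    show "g \<otimes>\<^bsub>B\<^esub> h \<in> F" if "g \<in> F" "h \<in> F" for g h
      using that mult[of g "\<one>\<^bsub>B\<^esub>" h "\<one>\<^bsub>B\<^esub>"] by (simp add: F_def)
    show "\<box>\<^bsub>B\<^esub> i g \<in> F" if "i \<in> I" "g \<in> F" for i g
      using that box[of i g "\<one>\<^bsub>B\<^esub>"] by (simp add: F_def box_one)
  qed
  moreover have "filter_rel B F \<inter> (S \<times> S) = \<theta>"
  proof (intro equalityI subsetI; clarify)
    fix x y assume "(x, y) \<in> filter_rel B F" and xy: "x \<in> S" "y \<in> S"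
    then obtain g where g: "(g, \<one>\<^bsub>B\<^esub>) \<in> \<theta>" "g \<otimes>\<^bsub>B\<^esub> x \<preceq>\<^bsub>B\<^esub> y" "g \<otimes>\<^bsub>B\<^esub> y \<preceq>\<^bsub>B\<^esub> x"
      by (auto simp: filter_rel_def F_def)
    \<comment> \<open>Multiplying \<open>(g, \<one>)\<close> by \<open>u\<close> relates
      \<open>g \<otimes> u\<close> to \<open>u\<close>. Meeting both sides with \<open>v\<close>
      fixes \<open>g \<otimes> u\<close>, which is already below \<open>v\<close>, and turns
      \<open>u\<close> into \<open>u \<curlywedge> v\<close>.\<close>
    have below: "(u, u \<curlywedge>\<^bsub>B\<^esub> v) \<in> \<theta>" if "g \<otimes>\<^bsub>B\<^esub> u \<preceq>\<^bsub>B\<^esub> v" "u \<in> S" "v \<in> S" for u v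
    proof -
      have gu: "(g \<otimes>\<^bsub>B\<^esub> u, u) \<in> \<theta>"
        using mult[OF g(1) refl[OF that(2)]] that SB by auto
      from meet[OF this refl[OF that(3)]] have "(g \<otimes>\<^bsub>B\<^esub> u, u \<curlywedge>\<^bsub>B\<^esub> v) \<in> \<theta>"
        using that(1) by (simp add: le_def)
      with gu show ?thesis
        using sym trans by blast
    qed
    \<comment> \<open>Both elements are congruent to their common meet, hence to each other.\<close>
    have "(x, x \<curlywedge>\<^bsub>B\<^esub> y) \<in> \<theta>" "(y, x \<curlywedge>\<^bsub>B\<^esub> y) \<in> \<theta>"
      using below[OF g(2) xy] below[OF g(3) xy(2,1)] meet_comm[of y x] xy SB by (simp_all add: subsetD)
    then show "(x, y) \<in> \<theta>"
      using sym trans by blast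
  next
    fix x y assume xy: "(x, y) \<in> \<theta>"
    then have S_xy: "x \<in> S" "y \<in> S" and c: "x \<in> carrier B" "y \<in> carrier B"
      using \<theta>_S SB by auto
    let ?g = "(x \<leadsto>\<^bsub>B\<^esub> y) \<otimes>\<^bsub>B\<^esub> (y \<leadsto>\<^bsub>B\<^esub> x)"
    \<comment> \<open>Replacing \<open>x\<close> by \<open>y\<close> modulo \<open>\<theta>\<close>
      turns either implication into \<open>y \<leadsto> y\<close>, which is
      \<open>\<one>\<close>.\<close>
    have "(x \<leadsto>\<^bsub>B\<^esub> y, \<one>\<^bsub>B\<^esub>) \<in> \<theta>" "(y \<leadsto>\<^bsub>B\<^esub> x, \<one>\<^bsub>B\<^esub>) \<in> \<theta>"
      using imp[OF xy refl[OF S_xy(2)]] imp[OF refl[OF S_xy(2)] xy] c by (simp_all add: imp_self)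
    then have "?g \<in> F"
      using mult[of "x \<leadsto>\<^bsub>B\<^esub> y" "\<one>\<^bsub>B\<^esub>" "y \<leadsto>\<^bsub>B\<^esub> x" "\<one>\<^bsub>B\<^esub>"] by (simp add: F_def)
    \<comment> \<open>In each inequality one factor of the witness acts by modus ponens and the
      other only decreases the product.\<close>
    moreover have "?g \<otimes>\<^bsub>B\<^esub> x \<preceq>\<^bsub>B\<^esub> y" "?g \<otimes>\<^bsub>B\<^esub> y \<preceq>\<^bsub>B\<^esub> x"
      using scaled_weaken[of "x \<leadsto>\<^bsub>B\<^esub> y" "y \<leadsto>\<^bsub>B\<^esub> x" x y y x] c by (simp_all add: imp_mult_le closed)
    ultimately show "(x, y) \<in> filter_rel B F \<inter> (S \<times> S)"
      using S_xy c by (auto simp: filter_rel_def)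
  qed
  ultimately show "\<exists>\<xi>. congruence I B \<xi> \<and> \<xi> \<inter> (S \<times> S) = \<theta>"
    by blast
qed

end
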